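(* Let \[ G=P_4[\overline{K}_{1},\overline{K}_{16},\overline{K}_{8},\overline{K}_{36}] \qquad\text{and}\qquad H=\mathsf{Paw}[\overline{K}_{4},\overline{K}_{9},\overline{K}_{16},\overline{K}_{32}]. \] Then $G$ and $H$ are connected and distance cospectral. Moreover, $G$ is bipartite and $H$ is non-bipartite.
   Context: All graphs are finite, simple and undirected. For a connected graph $X$, the distance matrix is $D(X)=(d_X(u,v))_{u,v\in V(X)}$, where $d_X(u,v)$ is the distance between $u$ and $v$, and $\chi_{D(X)}(\lambda)=\det(\lambda I-D(X))$ is its characteristic polynomial. The distance spectrum of $X$ is the multiset of eigenvalues of $D(X)$ (with multiplicities); two connected graphs are distance cospectral if they have the same distance spectrum. For a connected graph $F$ with vertex set $\{0,1,\ldots,r-1\}$, $r\ge 2$, and positive integers $m_0,\ldots,m_{r-1}$, the independent-set blow-up $F[\overline{K}_{m_0},\ldots,\overline{K}_{m_{r-1}}]$ is the graph obtained by replacing each vertex $i$ with an independent set $V_i$ of size $m_i$ (the $V_i$ pairwise disjoint) and each edge $ij\in E(F)$ with all edges between $V_i$ and $V_j$ (and no other edges). $P_4$ is the path on vertices $0,1,2,3$ with edges $01,12,23$. $\mathsf{Paw}$ is the paw graph on vertices $0,1,2,3$ with edges $01,02,03,12$ (a triangle $0,1,2$ with a pendant vertex $3$ attached to $0$). *)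

theory Defs
  imports "Graph_Theory.Graph_Theory" "Jordan_Normal_Form.Char_Poly"
begin

text \<open>
  Finite simple undirected graphs are the graphs \<^term>\<open>G :: 'a pair_pre_digraph\<close> with
  \<^prop>\<open>pair_graph G\<close>: an undirected edge is a pair of opposite arcs.
  Connectedness is \<^const>\<open>Digraph_Component.connected\<close>, which is not the
  topological notion of the same short name.
\<close>

definition graph_of_edges :: "'a set \<Rightarrow> ('a \<times> 'a) set \<Rightarrow> 'a pair_pre_digraph" where
  "graph_of_edges V E = \<lparr> pverts = V, parcs = E \<union> E\<inverse> \<rparr>"

definition P4 :: "nat pair_pre_digraph" where
  "P4 = graph_of_edges {0, 1, 2, 3} {(0, 1), (1, 2), (2, 3)}"

definition Paw :: "nat pair_pre_digraph" where
  "Paw = graph_of_edges {0, 1, 2, 3} {(0, 1), (0, 2), (0, 3), (1, 2)}"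

text \<open>
  For a graph \<^term>\<open>F\<close> on \<open>{0, ..., r - 1}\<close> and a list \<^term>\<open>ms\<close> of length \<open>r\<close>,
  the independent set replacing vertex \<open>i\<close> is \<open>{i} \<times> {0, ..., ms ! i - 1}\<close>.
\<close>

definition blow_up :: "nat pair_pre_digraph \<Rightarrow> nat list \<Rightarrow> (nat \<times> nat) pair_pre_digraph" where
  "blow_up F ms =
    \<lparr> pverts = {(i, k). i \<in> pverts F \<and> k < ms ! i},
      parcs = {((i, k), (j, l)). (i, j) \<in> parcs F \<and> k < ms ! i \<and> l < ms ! j} \<rparr>"

definition bipartite :: "'a pair_pre_digraph \<Rightarrow> bool" where
  "bipartite G \<longleftrightarrow> (\<exists>A B. A \<union> B = pverts G \<and> A \<inter> B = {} \<and>
     (\<forall>(u, v) \<in> parcs G. (u \<in> A \<and> v \<in> B) \<or> (u \<in> B \<and> v \<in> A)))"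

text \<open>
  The distance is the infimum of the lengths of the walks from \<open>u\<close> to \<open>v\<close>, that is, the
  shortest-path cost for unit arc weights. Without such a walk the infimum is infinite and
  \<^const>\<open>real_of_ereal\<close> gives 0; this does not occur in a connected graph.
\<close>

definition graph_dist :: "'a pair_pre_digraph \<Rightarrow> 'a \<Rightarrow> 'a \<Rightarrow> real" where
  "graph_dist G u v = real_of_ereal (wf_digraph.\<mu> (with_proj G) (\<lambda>_. 1) u v)"

text \<open>
  Matrices are indexed by natural numbers, so the rows and columns of the distance matrix
  are ordered by an enumeration \<^term>\<open>vs\<close> of the vertices. The spectrum does not depend
  on it, see \<open>distance_spectrum_eq\<close> below. Eigenvalues are taken over the complex numbers, so that
  the multiset contains all of them without reference to the matrix being symmetric.
\<close>

definition distance_matrix :: "'a pair_pre_digraph \<Rightarrow> 'a list \<Rightarrow> complex mat" where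
  "distance_matrix G vs = mat (length vs) (length vs)
     (\<lambda>(i, j). complex_of_real (graph_dist G (vs ! i) (vs ! j)))"

definition distance_spectrum :: "'a pair_pre_digraph \<Rightarrow> complex multiset" where
  "distance_spectrum G =
     proots (char_poly (distance_matrix G (SOME vs. distinct vs \<and> set vs = pverts G)))"

definition distance_cospectral :: "'a pair_pre_digraph \<Rightarrow> 'b pair_pre_digraph \<Rightarrow> bool" where
  "distance_cospectral G H \<longleftrightarrow> distance_spectrum G = distance_spectrum H"

lemma pair_graph_graph_of_edges:
  assumes "finite V" "E \<subseteq> V \<times> V" "\<And>v. (v, v) \<notin> E"
  shows "pair_graph (graph_of_edges V E)"
proof -
  have "finite E"
    using assms(1,2) finite_subset[of E "V \<times> V"] by simp
  moreover have "sym (E \<union> E\<inverse>)"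
    by (rule sym_Un_converse)
  ultimately show ?thesis
    using assms by unfold_locales (auto simp: graph_of_edges_def symmetric_def)
qed

lemma pair_graph_P4: "pair_graph P4"
  unfolding P4_def by (rule pair_graph_graph_of_edges) auto

lemma pair_graph_Paw: "pair_graph Paw"
  unfolding Paw_def by (rule pair_graph_graph_of_edges) auto

lemma pair_graph_blow_up:
  assumes "pair_graph F"
  shows "pair_graph (blow_up F ms)"
proof -
  interpret F: pair_graph F by fact
  have V: "pverts (blow_up F ms) = Sigma (pverts F) (\<lambda>i. {..<ms ! i})"
    by (auto simp: blow_up_def)
  have fin: "finite (pverts (blow_up F ms))"
    unfolding V by (intro finite_SigmaI) (auto simp: F.pair_finite_verts)
  have sub: "parcs (blow_up F ms) \<subseteq> pverts (blow_up F ms) \<times> pverts (blow_up F ms)"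
    by (auto simp: blow_up_def dest: F.in_arcsD1 F.in_arcsD2)
  have symF: "sym (parcs F)"
    using F.pair_sym_arcs by (simp add: symmetric_def)
  show ?thesis
  proof unfold_locales
    show "symmetric (with_proj (blow_up F ms))"
      using symF by (auto simp: symmetric_def blow_up_def sym_def)
    show "finite (parcs (blow_up F ms))"
      using sub fin by (rule finite_subset[OF _ finite_cartesian_product]) (fact fin)
    fix e assume "e \<in> parcs (blow_up F ms)"
    then show "fst e \<noteq> snd e"
      by (auto simp: blow_up_def dest: F.pair_no_loops)
  qed (use sub fin in auto)
qed

lemma char_poly_reindex:
  fixes A :: "'a :: comm_ring_1 mat"
  assumes A: "A \<in> carrier_mat n n" and p: "p permutes {0..<n}"
  shows "char_poly (mat n n (\<lambda>(i, j). A $$ (p i, p j))) = char_poly A"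
proof -
  define C where "C = char_poly_matrix A"
  have C: "C \<in> carrier_mat n n" using A by (simp add: C_def)
  have pi: "p i < n" if "i < n" for i
    using permutes_in_image[OF p, of i] that by simp
  have pinj: "p i = p j \<longleftrightarrow> i = j" for i j
    using permutes_inj[OF p] by (auto dest: injD)
  define R where "R = mat n n (\<lambda>(i, j). C $$ (p i, j))"
  have R: "R \<in> carrier_mat n n" by (simp add: R_def)
  have "char_poly_matrix (mat n n (\<lambda>(i, j). A $$ (p i, p j)))
      = transpose_mat (mat n n (\<lambda>(i, j). transpose_mat R $$ (p i, j)))"
    using A by (intro eq_matI)
      (auto simp: R_def C_def char_poly_matrix_def pi pinj)
  then have "char_poly (mat n n (\<lambda>(i, j). A $$ (p i, p j)))
      = det (mat n n (\<lambda>(i, j). transpose_mat R $$ (p i, j)))"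
    by (simp add: char_poly_def det_transpose[of _ n])
  also have "\<dots> = signof p * det (transpose_mat R)"
    using R by (intro det_permute_rows[OF _ p]) simp
  also have "det (transpose_mat R) = det R"
    using R by (rule det_transpose)
  also have "det R = signof p * det C"
    unfolding R_def by (rule det_permute_rows[OF C p])
  also have "signof p * (signof p * det C) = det C"
    by (simp add: sign_def)
  finally show ?thesis by (simp add: char_poly_def C_def)
qed

lemma distance_spectrum_eq:
  assumes "distinct vs" "set vs = pverts G"
  shows "distance_spectrum G = proots (char_poly (distance_matrix G vs))"
proof -
  define ws where "ws = (SOME vs. distinct vs \<and> set vs = pverts G)"
  have ws: "distinct ws \<and> set ws = pverts G"
    unfolding ws_def using assms by (rule someI[of _ vs, OF conjI])
  have "mset ws = mset vs"
    using assms ws set_eq_iff_mset_eq_distinct[of ws vs] by blast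
  then obtain p where p: "p permutes {..<length vs}" and ws': "permute_list p vs = ws"
    by (rule mset_eq_permutation)
  have len: "length ws = length vs" by (simp add: ws'[symmetric])
  have nth: "ws ! i = vs ! p i" if "i < length vs" for i
    using permute_list_nth[OF p that] by (simp add: ws')
  have pi: "p i < length vs" if "i < length vs" for i
    using permutes_in_image[OF p, of i] that by simp
  have "distance_matrix G ws = mat (length vs) (length vs)
      (\<lambda>(i, j). distance_matrix G vs $$ (p i, p j))"
    by (intro eq_matI) (auto simp: distance_matrix_def len nth pi)
  moreover have "distance_matrix G vs \<in> carrier_mat (length vs) (length vs)"
    by (simp add: distance_matrix_def)
  ultimately have "char_poly (distance_matrix G ws) = char_poly (distance_matrix G vs)"
    using char_poly_reindex[of "distance_matrix G vs" "length vs" p] p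
    by (simp add: atLeast0LessThan)
  then show ?thesis by (simp add: distance_spectrum_def ws_def)
qed

end

theory Submission
  imports Defs
begin

text \<open>
  In a blow-up, distinct vertices of one part are at distance 2 and the distance between vertices
  of different parts depends only on the parts. So \<open>D + 2 I\<close> has rank at most 4, and by Sylvester's
  determinant identity its characteristic polynomial is a power of the variable times that of a
  \<open>4 \<times> 4\<close> quotient matrix. Both graphs have 61 vertices, and their quotient matrices have
  the same characteristic polynomial.
\<close>

section \<open>Distances certified by a level function\<close>

text \<open>By \<open>step\<close>, \<open>f\<close> grows by at most one per arc, so no walk from
  \<open>u\<close> to \<open>v\<close> is shorter than \<open>f v\<close>. By \<open>pred\<close>,
  one can descend from \<open>v\<close> level by level until \<open>u\<close> is reached, which
  gives a walk of exactly that length.\<close>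

lemma graph_dist_eqI:
  fixes G :: "'a pair_pre_digraph" and f :: "'a \<Rightarrow> nat"
  assumes "pair_wf_digraph G"
    and "u \<in> pverts G" and "v \<in> pverts G"
    and start: "f u = 0"
    and step: "\<And>x y. (x, y) \<in> parcs G \<Longrightarrow> f y \<le> f x + 1"
    and pred: "\<And>y. y \<in> pverts G \<Longrightarrow> y \<noteq> u \<Longrightarrow> \<exists>x. (x, y) \<in> parcs G \<and> f x + 1 = f y"
  shows "graph_dist G u v = real (f v)" and "u \<rightarrow>\<^sup>*\<^bsub>with_proj G\<^esub> v"
proof -
  interpret pair_wf_digraph G by fact
  have cost: "awalk_cost (\<lambda>_. 1) p = real (length p)" for p :: "('a \<times> 'a) list"
    by (induction p) (auto simp: awalk_cost_def)
  have lower: "f y \<le> f x + length p" if "awalk x p y" for x p y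
    using that
  proof (induction p arbitrary: x)
    case Nil
    then show ?case by (simp add: awalk_Nil_iff)
  next
    case (Cons e p)
    then have "e \<in> parcs G" "x = fst e" "awalk (snd e) p y"
      by (auto simp: awalk_Cons_iff)
    with Cons.IH[of "snd e"] step[of "fst e" "snd e"] show ?case by simp
  qed
  have "\<exists>p. awalk u p y \<and> length p = f y" if "y \<in> pverts G" for y
    using that
  proof (induction "f y" arbitrary: y rule: less_induct)
    case less
    show ?case
    proof (cases "y = u")
      case True
      then show ?thesis using less.prems start by (auto simp: awalk_Nil_iff intro!: exI[of _ "[]"])
    next
      case False
      then obtain x where x: "(x, y) \<in> parcs G" "f x + 1 = f y"
        using pred less.prems by blast
      then obtain p where "awalk u p x" "length p = f x"
        using less.hyps[of x] by (auto dest: in_arcsD1)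
      moreover have "awalk x [(x, y)] y"
        using x less.prems by (simp add: awalk_simps)
      ultimately have "awalk u (p @ [(x, y)]) y \<and> length (p @ [(x, y)]) = f y"
        using x by (auto intro: awalk_appendI)
      then show ?thesis by blast
    qed
  qed
  then obtain p where p: "awalk u p v" "length p = f v" using assms by blast
  then show "u \<rightarrow>\<^sup>*\<^bsub>with_proj G\<^esub> v" by (auto simp: reachable_awalk)
  have "\<mu> (\<lambda>_. 1) u v = ereal (real (f v))"
  proof (rule antisym)
    show "\<mu> (\<lambda>_. 1) u v \<le> ereal (real (f v))"
      using min_cost_le_walk_cost[OF p(1), of "\<lambda>_. 1"] p(2) by (simp add: cost)
    show "ereal (real (f v)) \<le> \<mu> (\<lambda>_. 1) u v"
      unfolding \<mu>_def using lower start by (fastforce intro: INF_greatest simp: cost)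
  qed
  then show "graph_dist G u v = real (f v)" by (simp add: graph_dist_def)
qed

section \<open>Sylvester's determinant identity\<close>

text \<open>The block matrix \<open>?M\<close> is made block triangular in two ways:
  \<open>?R\<close> on the right clears the block \<open>B\<close> and leaves
  \<open>t I - A B\<close>, while \<open>?L\<close> on the left clears it and leaves
  \<open>t I - B A\<close>. Placing \<open>t\<close> inside \<open>?L\<close> costs the factor
  \<open>t ^ k\<close> but avoids division by \<open>t\<close>, so \<open>t = 0\<close> is
  covered.\<close>

lemma det_diagonal_minus_mult_swap:
  fixes A B :: "'a :: idom mat"
  assumes A: "A \<in> carrier_mat n k" and B: "B \<in> carrier_mat k n"
  shows "t ^ k * det (t \<cdot>\<^sub>m 1\<^sub>m n - A * B) = t ^ n * det (t \<cdot>\<^sub>m 1\<^sub>m k - B * A)"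
proof -
  let ?M = "four_block_mat (t \<cdot>\<^sub>m 1\<^sub>m n) A B (1\<^sub>m k)"
  let ?R = "four_block_mat (1\<^sub>m n) (0\<^sub>m n k) (- B) (1\<^sub>m k)"
  let ?L = "four_block_mat (1\<^sub>m n) (0\<^sub>m n k) (- B) (t \<cdot>\<^sub>m 1\<^sub>m k)"
  have carr: "?M \<in> carrier_mat (n + k) (n + k)" "?R \<in> carrier_mat (n + k) (n + k)"
    "?L \<in> carrier_mat (n + k) (n + k)" by auto
  have AB: "t \<cdot>\<^sub>m 1\<^sub>m n - A * B \<in> carrier_mat n n" and BA: "t \<cdot>\<^sub>m 1\<^sub>m k - B * A \<in> carrier_mat k k"
    using A B by auto
  have "?M * ?R = four_block_mat (t \<cdot>\<^sub>m 1\<^sub>m n - A * B) A (0\<^sub>m k n) (1\<^sub>m k)"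
    using A B by (subst mult_four_block_mat[of _ n n _ k _ k _ _ n _ k])
      (auto intro!: cong_four_block_mat eq_matI)
  then have "det ?M * det ?R = det (t \<cdot>\<^sub>m 1\<^sub>m n - A * B)"
    using A AB BA carr by (simp add: det_mult[of _ "n + k", symmetric]
        det_four_block_mat_lower_left_zero[of _ n _ k])
  moreover have "det ?R = 1"
    using B by (simp add: det_four_block_mat_upper_right_zero[of _ n _ k])
  moreover have "?L * ?M = four_block_mat (t \<cdot>\<^sub>m 1\<^sub>m n) A (0\<^sub>m k n) (t \<cdot>\<^sub>m 1\<^sub>m k - B * A)"
    using A B by (subst mult_four_block_mat[of _ n n _ k _ k _ _ n _ k])
      (auto intro!: cong_four_block_mat eq_matI)
  then have "det ?L * det ?M = t ^ n * det (t \<cdot>\<^sub>m 1\<^sub>m k - B * A)"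
    using A AB BA carr by (simp add: det_mult[of _ "n + k", symmetric]
        det_four_block_mat_lower_left_zero[of _ n _ k])
  moreover have "det ?L = t ^ k"
    using B by (simp add: det_four_block_mat_upper_right_zero[of _ n _ k])
  ultimately show ?thesis by simp
qed

lemma poly_char_poly_eq_det:
  fixes A :: "'a :: field mat"
  assumes A: "A \<in> carrier_mat n n"
  shows "poly (char_poly A) x = det (x \<cdot>\<^sub>m 1\<^sub>m n - A)"
  unfolding char_poly_matrix[OF A]
  by (rule arg_cong[of _ _ det], rule eq_matI) (use A in \<open>auto simp: char_matrix_def\<close>)

section \<open>Distances and characteristic polynomials of blow-ups\<close>

text \<open>For \<open>W\<close> as in \<open>blow_up_distances\<close>, this is the quotient of
  \<open>D + 2 I\<close> by the equitable partition into parts: entry \<open>(i, j)\<close> sums a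
  row of part \<open>i\<close> over the columns of part \<open>j\<close>. Hence the diagonal has
  \<open>2 * ms ! i\<close> and not \<open>2 * (ms ! i - 1)\<close>.\<close>

definition quotient_matrix :: "nat \<Rightarrow> nat list \<Rightarrow> (nat \<Rightarrow> nat \<Rightarrow> nat) \<Rightarrow> complex mat" where
  "quotient_matrix r ms W = mat r r (\<lambda>(i, j). of_nat (W i j * ms ! j))"

text \<open>
  \<open>W i j\<close> is the distance between distinct vertices in the parts of \<open>i\<close> and \<open>j\<close>; on the
  diagonal it is 2, because two vertices of one part have a common neighbour.
\<close>

locale blow_up_distances = pair_graph F for F :: "nat pair_pre_digraph" +
  fixes r :: nat and ms :: "nat list" and W :: "nat \<Rightarrow> nat \<Rightarrow> nat"
  assumes verts: "pverts F = {..<r}"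
    and r_pos: "0 < r"
    and size_pos: "i < r \<Longrightarrow> 0 < ms ! i"
    and W_diag: "i < r \<Longrightarrow> W i i = 2"
    and W_eq_1: "i < r \<Longrightarrow> j < r \<Longrightarrow> W i j = 1 \<longleftrightarrow> (i, j) \<in> parcs F"
    and W_step: "i < r \<Longrightarrow> (j, k) \<in> parcs F \<Longrightarrow> W i k \<le> W i j + 1"
    and W_pred: "i < r \<Longrightarrow> j < r \<Longrightarrow> W i j \<noteq> 1 \<Longrightarrow>
      \<exists>k<r. (k, j) \<in> parcs F \<and> W i k + 1 = W i j"
begin

lemma verts_blow_up: "pverts (blow_up F ms) = Sigma {..<r} (\<lambda>i. {..<ms ! i})"
  by (auto simp: blow_up_def verts)

text \<open>The values of \<open>W\<close>, reset to 0 at \<open>u\<close> alone, form a level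
  function for \<open>graph_dist_eqI\<close>; the other vertices in the part of \<open>u\<close>
  keep the diagonal value 2.\<close>

lemma
  assumes u: "u \<in> pverts (blow_up F ms)" and v: "v \<in> pverts (blow_up F ms)"
  shows graph_dist_blow_up:
      "graph_dist (blow_up F ms) u v = (if v = u then 0 else real (W (fst u) (fst v)))"
    and reachable_blow_up: "u \<rightarrow>\<^sup>*\<^bsub>with_proj (blow_up F ms)\<^esub> v"
proof -
  interpret B: pair_graph "blow_up F ms" by (rule pair_graph_blow_up) unfold_locales
  define f where "f v = (if v = u then 0 else W (fst u) (fst v))" for v
  have i: "fst u < r" using u by (auto simp: verts_blow_up)
  have step: "f y \<le> f x + 1" if "(x, y) \<in> parcs (blow_up F ms)" for x y
  proof -
    have "(fst x, fst y) \<in> parcs F" using that by (auto simp: blow_up_def)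
    moreover from this have "fst x < r" "fst y < r"
      using in_arcsD1 in_arcsD2 verts by auto
    ultimately show ?thesis
      using W_step[OF i, of "fst x" "fst y"] W_eq_1[OF i, of "fst y"] W_diag i
      by (auto simp: f_def)
  qed
  have pred: "\<exists>x. (x, y) \<in> parcs (blow_up F ms) \<and> f x + 1 = f y"
    if y: "y \<in> pverts (blow_up F ms)" "y \<noteq> u" for y
  proof (cases "W (fst u) (fst y) = 1")
    \<comment> \<open>At level 1 the predecessor is \<open>u\<close> itself, at level 0 only because
      of the reset: \<open>W\<close> gives its part the value 2, so \<open>W_pred\<close> excludes
      this case.\<close>
    case True
    then have "(u, y) \<in> parcs (blow_up F ms)"
      using u y W_eq_1 by (auto simp: blow_up_def verts)
    then show ?thesis using True y by (intro exI[of _ u]) (simp add: f_def)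
  next
    case False
    have j: "fst y < r" using y by (auto simp: verts_blow_up)
    obtain k where k: "k < r" "(k, fst y) \<in> parcs F" "W (fst u) k + 1 = W (fst u) (fst y)"
      using W_pred[OF i j False] by blast
    \<comment> \<open>An arc from \<open>fst u\<close> to \<open>fst y\<close> would force level 1.
      So the representative \<open>(k, 0)\<close> differs from \<open>u\<close> and its level is
      given by \<open>W\<close>.\<close>
    have "k \<noteq> fst u" using False W_eq_1 i j k by auto
    then have "(k, 0) \<noteq> u" by auto
    with k y size_pos[of k] show ?thesis
      by (intro exI[of _ "(k, 0)"]) (cases y, auto simp: f_def blow_up_def)
  qed
  note * = graph_dist_eqI[of "blow_up F ms" u v f, OF _ u v _ step pred]
  have wf: "pair_wf_digraph (blow_up F ms)" by unfold_locales
  show "graph_dist (blow_up F ms) u v = (if v = u then 0 else real (W (fst u) (fst v)))"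
    using *(1)[OF wf] by (simp add: f_def)
  show "u \<rightarrow>\<^sup>*\<^bsub>with_proj (blow_up F ms)\<^esub> v"
    using *(2)[OF wf] by (simp add: f_def)
qed

lemma connected_blow_up: "Digraph_Component.connected (with_proj (blow_up F ms))"
proof -
  interpret B: pair_graph "blow_up F ms" by (rule pair_graph_blow_up) unfold_locales
  have "(0, 0) \<in> pverts (blow_up F ms)"
    using r_pos size_pos by (auto simp: verts_blow_up)
  then show ?thesis
    unfolding connected_def
    by (intro strongly_connectedI)
      (auto intro!: B.reachable_mk_symmetricI intro: reachable_blow_up)
qed

text \<open>
  With the incidence matrix \<open>P\<close> of vertices and parts, \<open>D + 2 I = P W P\<^sup>T\<close>, and
  \<open>W P\<^sup>T P\<close> is the quotient matrix.
\<close>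

lemma char_poly_distance_matrix_blow_up:
  assumes vs: "distinct vs" "set vs = pverts (blow_up F ms)"
  shows "(x + 2) ^ r * poly (char_poly (distance_matrix (blow_up F ms) vs)) x =
    (x + 2) ^ length vs * poly (char_poly (quotient_matrix r ms W)) (x + 2)"
proof -
  define n where "n = length vs"
  \<comment> \<open>\<open>A\<close> is the incidence matrix \<open>P\<close> and \<open>B\<close>
    is \<open>W P^T\<close>, so \<open>A * B\<close> is the large matrix \<open>D + 2 I\<close> and
    \<open>B * A\<close> the small quotient.\<close>
  define A :: "complex mat" where "A = mat n r (\<lambda>(a, i). if fst (vs ! a) = i then 1 else 0)"
  define B :: "complex mat" where "B = mat r n (\<lambda>(i, b). of_nat (W i (fst (vs ! b))))"
  let ?Q = "quotient_matrix r ms W"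
  let ?D = "distance_matrix (blow_up F ms) vs"
  have carr: "A \<in> carrier_mat n r" "B \<in> carrier_mat r n" "?D \<in> carrier_mat n n"
    "?Q \<in> carrier_mat r r"
    by (auto simp: A_def B_def distance_matrix_def n_def quotient_matrix_def)
  have mem: "vs ! a \<in> pverts (blow_up F ms)" if "a < n" for a
    using vs(2) that nth_mem unfolding n_def by blast
  then have part: "fst (vs ! a) < r" if "a < n" for a
    using mem[OF that] by (auto simp: verts_blow_up)
  have AB: "(A * B) $$ (a, b) = of_nat (W (fst (vs ! a)) (fst (vs ! b)))" if "a < n" "b < n" for a b
  proof -
    have "(A * B) $$ (a, b) = (\<Sum>i\<in>{0..<r}. if fst (vs ! a) = i then of_nat (W i (fst (vs ! b))) else 0)"
      using that by (auto simp: A_def B_def scalar_prod_def simp del: sum.delta sum.delta' intro!: sum.cong)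
    then show ?thesis using part[OF that(1)] by simp
  qed
  \<comment> \<open>The shift by 2 compensates the diagonal, where \<open>?D\<close> has 0 and
    \<open>A * B\<close> has 2.\<close>
  have "x \<cdot>\<^sub>m 1\<^sub>m n - ?D = (x + 2) \<cdot>\<^sub>m 1\<^sub>m n - A * B"
  proof (rule eq_matI)
    fix a b
    assume "a < dim_row ((x + 2) \<cdot>\<^sub>m 1\<^sub>m n - A * B)" "b < dim_col ((x + 2) \<cdot>\<^sub>m 1\<^sub>m n - A * B)"
    then have ab: "a < n" "b < n" using carr by auto
    moreover have "vs ! a = vs ! b \<longleftrightarrow> a = b"
      using ab vs(1) by (simp add: n_def nth_eq_iff_index_eq)
    moreover have "?D $$ (a, b) = (if a = b then 0 else of_nat (W (fst (vs ! a)) (fst (vs ! b))))"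
      using calculation graph_dist_blow_up[OF mem[OF ab(1)] mem[OF ab(2)]]
      by (auto simp: distance_matrix_def n_def)
    moreover have "W (fst (vs ! a)) (fst (vs ! a)) = 2"
      using W_diag part ab by simp
    ultimately show "(x \<cdot>\<^sub>m 1\<^sub>m n - ?D) $$ (a, b) = ((x + 2) \<cdot>\<^sub>m 1\<^sub>m n - A * B) $$ (a, b)"
      using carr AB[OF ab] by (auto simp del: index_mult_mat(1))
  qed (use carr in auto)
  moreover have "B * A = ?Q"
  proof (rule eq_matI)
    fix i j
    assume "i < dim_row ?Q" "j < dim_col ?Q"
    then have ij: "i < r" "j < r" by (auto simp: quotient_matrix_def)
    \<comment> \<open>Column \<open>j\<close> of \<open>A\<close> selects the vertices of part
      \<open>j\<close>, each contributing \<open>W i j\<close>; it remains to count them as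
      \<open>ms ! j\<close>.\<close>
    have "(B * A) $$ (i, j) = (\<Sum>b<n. if fst (vs ! b) = j then of_nat (W i j) else 0)"
      using ij by (auto simp: A_def B_def scalar_prod_def lessThan_atLeast0 simp del: sum.delta sum.delta' intro!: sum.cong)
    also have "\<dots> = (\<Sum>v\<leftarrow>vs. if fst v = j then of_nat (W i j) else 0)"
      by (simp add: sum_list_sum_nth n_def lessThan_atLeast0)
    also have "\<dots> = (\<Sum>v\<in>set vs. if fst v = j then of_nat (W i j) else 0)"
      using vs(1) by (rule sum_list_distinct_conv_sum_set)
    also have "\<dots> = (\<Sum>k<r. \<Sum>l<ms ! k. if k = j then of_nat (W i j) else 0)"
      unfolding vs(2) verts_blow_up by (subst sum.Sigma) (auto intro!: sum.cong)
    also have "\<dots> = (\<Sum>k<r. if k = j then of_nat (W i j * ms ! j) else 0)"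
      by (intro sum.cong) auto
    also have "\<dots> = ?Q $$ (i, j)"
      using ij by (simp add: quotient_matrix_def)
    finally show "(B * A) $$ (i, j) = ?Q $$ (i, j)" .
  qed (use carr in auto)
  ultimately show ?thesis
    using det_diagonal_minus_mult_swap[OF carr(1,2), of "x + 2"]
    by (simp add: poly_char_poly_eq_det[OF carr(3)] poly_char_poly_eq_det[OF carr(4)] n_def)
qed

lemma card_verts_blow_up: "card (pverts (blow_up F ms)) = (\<Sum>i<r. ms ! i)"
  by (simp add: verts_blow_up)

end

section \<open>Cospectrality from equal quotient polynomials\<close>

lemma distance_cospectral_blow_upI:
  assumes F: "blow_up_distances F r ms W" and F': "blow_up_distances F' r ms' W'"
    and size: "(\<Sum>i<r. ms ! i) = (\<Sum>i<r. ms' ! i)"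
    and char: "char_poly (quotient_matrix r ms W) =
      char_poly (quotient_matrix r ms' W')"
  shows "distance_cospectral (blow_up F ms) (blow_up F' ms')"
proof -
  interpret F: blow_up_distances F r ms W by fact
  interpret F': blow_up_distances F' r ms' W' by fact
  have "finite (pverts (blow_up F ms))" "finite (pverts (blow_up F' ms'))"
    by (auto simp: F.verts_blow_up F'.verts_blow_up)
  then obtain vs vs' where vs: "distinct vs" "set vs = pverts (blow_up F ms)"
    and vs': "distinct vs'" "set vs' = pverts (blow_up F' ms')"
    using finite_distinct_list by metis
  let ?p = "char_poly (distance_matrix (blow_up F ms) vs)"
  let ?p' = "char_poly (distance_matrix (blow_up F' ms') vs')"
  have len: "length vs = length vs'"
    using size F.card_verts_blow_up F'.card_verts_blow_up vs vs' distinct_card by metis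
  \<comment> \<open>The factor \<open>(x + 2) ^ r\<close> vanishes at -2 and cannot be cancelled
    pointwise. It is therefore written as a power of the polynomial \<open>[:2, 1:]\<close>, which
    is nonzero and cancels after passing from values to polynomials.\<close>
  have "poly ([:2, 1:] ^ r * ?p) x = poly ([:2, 1:] ^ r * ?p') x" for x
    using F.char_poly_distance_matrix_blow_up[OF vs, of x]
      F'.char_poly_distance_matrix_blow_up[OF vs', of x]
    by (simp add: char len add.commute)
  then have "[:2, 1:] ^ r * ?p = [:2, 1:] ^ r * ?p'"
    by (simp add: poly_eq_poly_eq_iff[symmetric] fun_eq_iff)
  then have "?p = ?p'" by simp
  then show ?thesis
    by (simp add: distance_cospectral_def distance_spectrum_eq[OF vs] distance_spectrum_eq[OF vs'])
qed

section \<open>Determinants of order 4\<close>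

text \<open>Laplace expansion along row 0. The minors are again matrices given by a function, so the
  rule can be iterated by rewriting.\<close>

lemma det_mat_Suc:
  fixes f :: "nat \<Rightarrow> nat \<Rightarrow> 'a :: comm_ring_1"
  shows "det (mat (Suc n) (Suc n) (\<lambda>(i, j). f i j)) = (\<Sum>j<Suc n. (-1) ^ j * f 0 j *
    det (mat n n (\<lambda>(a, b). f (Suc a) (if b < j then b else Suc b))))"
proof -
  have del: "mat_delete (mat (Suc n) (Suc n) (\<lambda>(i, j). f i j)) 0 j =
      mat n n (\<lambda>(a, b). f (Suc a) (if b < j then b else Suc b))" for j
    by (rule eq_matI) (auto simp: mat_delete_def)
  show ?thesis
    by (subst laplace_expansion_row[of _ "Suc n" 0])
      (auto simp: cofactor_def del intro!: sum.cong)
qed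

lemma det_mat_4:
  fixes f :: "nat \<Rightarrow> nat \<Rightarrow> 'a :: comm_ring_1"
  shows "det (mat 4 4 (\<lambda>(i, j). f i j)) =
    f 0 0 * (f 1 1 * (f 2 2 * f 3 3 - f 2 3 * f 3 2) -
      f 1 2 * (f 2 1 * f 3 3 - f 2 3 * f 3 1) +
      f 1 3 * (f 2 1 * f 3 2 - f 2 2 * f 3 1)) -
    f 0 1 * (f 1 0 * (f 2 2 * f 3 3 - f 2 3 * f 3 2) -
      f 1 2 * (f 2 0 * f 3 3 - f 2 3 * f 3 0) +
      f 1 3 * (f 2 0 * f 3 2 - f 2 2 * f 3 0)) +
    f 0 2 * (f 1 0 * (f 2 1 * f 3 3 - f 2 3 * f 3 1) -
      f 1 1 * (f 2 0 * f 3 3 - f 2 3 * f 3 0) +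
      f 1 3 * (f 2 0 * f 3 1 - f 2 1 * f 3 0)) -
    f 0 3 * (f 1 0 * (f 2 1 * f 3 2 - f 2 2 * f 3 1) -
      f 1 1 * (f 2 0 * f 3 2 - f 2 2 * f 3 0) +
      f 1 2 * (f 2 0 * f 3 1 - f 2 1 * f 3 0))"
proof -
  have 4: "(4 :: nat) = Suc (Suc (Suc (Suc 0)))" by simp
  show ?thesis
    unfolding 4 by (simp add: det_mat_Suc lessThan_Suc numeral_2_eq_2 numeral_3_eq_3 algebra_simps)
qed

section \<open>The path and the paw\<close>

text \<open>This table and \<open>W_Paw\<close> are the distance matrices of the path and the paw,
  with the diagonal 0 replaced by 2.\<close>

definition W_P4 :: "nat \<Rightarrow> nat \<Rightarrow> nat" where
  "W_P4 i j = [[2, 1, 2, 3], [1, 2, 1, 2], [2, 1, 2, 1], [3, 2, 1, 2]] ! i ! j"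

definition W_Paw :: "nat \<Rightarrow> nat \<Rightarrow> nat" where
  "W_Paw i j = [[2, 1, 1, 1], [1, 2, 1, 2], [1, 1, 2, 2], [1, 2, 2, 2]] ! i ! j"

lemma less_4_iff: "i < 4 \<longleftrightarrow> i = 0 \<or> i = 1 \<or> i = 2 \<or> i = (3 :: nat)"
  by auto

lemma blow_up_distances_P4: "blow_up_distances P4 4 [1, 16, 8, 36] W_P4"
proof -
  interpret pair_graph P4 by (rule pair_graph_P4)
  \<comment> \<open>Reading arcs as entries 1 turns the locale assumptions into bounded statements
    about the table, decided by evaluation.\<close>
  have parcs: "(i, j) \<in> parcs P4 \<longleftrightarrow> i < 4 \<and> j < 4 \<and> W_P4 i j = 1" for i j
    unfolding less_4_iff by (auto simp: W_P4_def P4_def graph_of_edges_def)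
  have size_pos: "\<forall>i<4. 0 < ([1, 16, 8, 36] :: nat list) ! i" by code_simp
  have diag: "\<forall>i<4. W_P4 i i = 2" by code_simp
  have step: "\<forall>i<4. \<forall>j<4. \<forall>k<4. W_P4 j k = 1 \<longrightarrow> W_P4 i k \<le> W_P4 i j + 1" by code_simp
  have pred: "\<forall>i<4. \<forall>j<4. W_P4 i j \<noteq> 1 \<longrightarrow> (\<exists>k<4. W_P4 k j = 1 \<and> W_P4 i k + 1 = W_P4 i j)"
    by code_simp
  have "pverts P4 = {..<4}"
    by (auto simp: P4_def graph_of_edges_def)
  with size_pos diag step pred show ?thesis
    by unfold_locales (auto simp: parcs simp del: One_nat_def)
qed

lemma blow_up_distances_Paw: "blow_up_distances Paw 4 [4, 9, 16, 32] W_Paw"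
proof -
  interpret pair_graph Paw by (rule pair_graph_Paw)
  have parcs: "(i, j) \<in> parcs Paw \<longleftrightarrow> i < 4 \<and> j < 4 \<and> W_Paw i j = 1" for i j
    unfolding less_4_iff by (auto simp: W_Paw_def Paw_def graph_of_edges_def)
  have size_pos: "\<forall>i<4. 0 < ([4, 9, 16, 32] :: nat list) ! i" by code_simp
  have diag: "\<forall>i<4. W_Paw i i = 2" by code_simp
  have step: "\<forall>i<4. \<forall>j<4. \<forall>k<4. W_Paw j k = 1 \<longrightarrow> W_Paw i k \<le> W_Paw i j + 1" by code_simp
  have pred: "\<forall>i<4. \<forall>j<4. W_Paw i j \<noteq> 1 \<longrightarrow> (\<exists>k<4. W_Paw k j = 1 \<and> W_Paw i k + 1 = W_Paw i j)"
    by code_simp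
  have "pverts Paw = {..<4}"
    by (auto simp: Paw_def graph_of_edges_def)
  with size_pos diag step pred show ?thesis
    by unfold_locales (auto simp: parcs simp del: One_nat_def)
qed

text \<open>The part sizes matter here: both polynomials are
  \<open>x^4 - 122 x^3 + 1116 x^2 + 6912 x - 55296\<close>. Equality is checked at every
  \<open>x\<close> by expanding the determinants.\<close>

lemma char_poly_quotients_eq:
  "char_poly (quotient_matrix 4 [1, 16, 8, 36] W_P4) =
    char_poly (quotient_matrix 4 [4, 9, 16, 32] W_Paw)"
proof -
  have det: "poly (char_poly (quotient_matrix 4 ms W)) x =
      det (mat 4 4 (\<lambda>(i, j). (if i = j then x else 0) - of_nat (W i j * ms ! j)))" for ms W x
    unfolding quotient_matrix_def
    by (subst poly_char_poly_eq_det[of _ 4]) (auto intro!: arg_cong[of _ _ det])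
  have "poly (char_poly (quotient_matrix 4 [1, 16, 8, 36] W_P4)) x =
      poly (char_poly (quotient_matrix 4 [4, 9, 16, 32] W_Paw)) x" for x
    unfolding det det_mat_4 by (simp add: W_P4_def W_Paw_def algebra_simps)
  then show ?thesis by (simp add: poly_eq_poly_eq_iff[symmetric] fun_eq_iff)
qed

theorem theorem3p1:
  fixes G H :: "(nat \<times> nat) pair_pre_digraph"
  defines "G \<equiv> blow_up P4 [1, 16, 8, 36]"
    and "H \<equiv> blow_up Paw [4, 9, 16, 32]"
  shows "Digraph_Component.connected (with_proj G) \<and> Digraph_Component.connected (with_proj H) \<and>
    distance_cospectral G H \<and> bipartite G \<and> \<not> bipartite H"
proof (intro conjI)
  show "Digraph_Component.connected (with_proj G)"
    unfolding G_def by (rule blow_up_distances.connected_blow_up[OF blow_up_distances_P4])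
  show "Digraph_Component.connected (with_proj H)"
    unfolding H_def by (rule blow_up_distances.connected_blow_up[OF blow_up_distances_Paw])
  show "distance_cospectral G H"
    unfolding G_def H_def
    using blow_up_distances_P4 blow_up_distances_Paw _ char_poly_quotients_eq
    by (rule distance_cospectral_blow_upI) (simp add: eval_nat_numeral)
  show "bipartite G"
    unfolding bipartite_def
    \<comment> \<open>Every edge of the path joins vertices of opposite parity, and the blow-up
      inherits this colouring.\<close>
    by (rule exI[of _ "{v \<in> pverts G. even (fst v)}"], rule exI[of _ "{v \<in> pverts G. odd (fst v)}"])
      (auto simp: G_def P4_def graph_of_edges_def blow_up_def)
  \<comment> \<open>The triangle 0, 1, 2 of the paw lifts to first vertices of nonempty parts; two
    of its three vertices would share a side.\<close>
  have triangle: "((0, 0), (1, 0)) \<in> parcs H" "((1, 0), (2, 0)) \<in> parcs H" "((0, 0), (2, 0)) \<in> parcs H"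
    by (auto simp: H_def Paw_def graph_of_edges_def blow_up_def)
  show "\<not> bipartite H"
  proof
    assume "bipartite H"
    then obtain A B where disj: "A \<inter> B = {}"
      and arc: "\<forall>(u, v) \<in> parcs H. (u \<in> A \<and> v \<in> B) \<or> (u \<in> B \<and> v \<in> A)"
      unfolding bipartite_def by (elim exE conjE)
    from disj triangle[THEN arc[THEN bspec], unfolded prod.case] show False by blast
  qed
qed

end
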